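(* The powerset monad $(P,\{-\},\bigcup)$ on $\mathsf{Set}$ can be lifted along the forgetful functor $\mathcal V\text{-}\mathsf{Cat}\to\mathsf{Set}$ to a monad $\mathbb H=(H,\{-\},\bigcup)$ on $\mathcal V\text{-}\mathsf{Cat}$ of Kock-Zöberlein type, where $H$ is the Hausdorff functor.
   Context: $\mathcal V$ is a commutative unital quantale: a complete lattice with a commutative, associative operation $\otimes$ with neutral element $k$, such that $\otimes$ preserves arbitrary suprema in each variable; it is assumed that $k>\bot$. A $\mathcal V$-category $X=(X,a)$ is a set $X$ with $a:X\times X\to\mathcal V$ satisfying $k\le a(x,x)$ and $a(x,y)\otimes a(y,z)\le a(x,z)$. A $\mathcal V$-functor $f:(X,a)\to(Y,b)$ is a map with $a(x,y)\le b(f(x),f(y))$. $\mathcal V\text{-}\mathsf{Cat}$ is the resulting category. The induced (pre)order of $X$ is $x\le y\iff k\le a(x,y)$; $\mathcal V$-functors are ordered by $f\le g\iff f(x)\le g(x)$ for all $x$, making $\mathcal V\text{-}\mathsf{Cat}$ order-enriched (a 2-category). The Hausdorff functor $H:\mathcal V\text{-}\mathsf{Cat}\to\mathcal V\text{-}\mathsf{Cat}$ sends $X=(X,a)$ to $HX=(PX,h_X)$, where $PX$ is the powerset of $X$ and $h_X(A,B)=\bigwedge_{x\in A}\bigvee_{y\in B}a(x,y)$, and sends $f:X\to Y$ to $Hf:A\mapsto f(A)$ (direct image). The powerset monad has unit $x\mapsto\{x\}$ and multiplication $\mathcal A\mapsto\bigcup\mathcal A$. That $\mathbb H$ lifts it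 means that $H$, and the unit and multiplication of $\mathbb H$, have the direct-image functor $P$ and these maps as underlying functor and maps. A monad $(T,\eta,\mu)$ on $\mathcal V\text{-}\mathsf{Cat}$ is of Kock-Zöberlein type if $T$ preserves the order of hom-sets and $T\eta_X\le\eta_{TX}$ for all $X$. *)

theory Defs
  imports Main "HOL-Library.FuncSet"
begin

(* The tensor is written * and its neutral element k is written 1. *)
class comm_unital_quantale = complete_lattice + comm_monoid_mult +
  assumes mult_Sup: "x * Sup A = (SUP y\<in>A. x * y)"
    and bot_less_one: "bot < 1"
begin

lemma Sup_mult: "Sup A * x = (SUP y\<in>A. y * x)"
  using mult_Sup[of x A] by (simp add: mult.commute)

end

(* Values of vdist outside pts are irrelevant: every notion below only uses those on pts. *)
record ('a, 'v) vgraph =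
  pts :: "'a set"
  vdist :: "'a \<Rightarrow> 'a \<Rightarrow> 'v"

definition vcategory :: "('a, 'v::comm_unital_quantale) vgraph \<Rightarrow> bool" where
  "vcategory X \<longleftrightarrow>
     (\<forall>x\<in>pts X. 1 \<le> vdist X x x) \<and>
     (\<forall>x\<in>pts X. \<forall>y\<in>pts X. \<forall>z\<in>pts X. vdist X x y * vdist X y z \<le> vdist X x z)"

definition vle :: "('a, 'v::comm_unital_quantale) vgraph \<Rightarrow> 'a \<Rightarrow> 'a \<Rightarrow> bool" where
  "vle X x y \<longleftrightarrow> 1 \<le> vdist X x y"

(* Morphisms are extensional functions, so that HOL equality is equality of morphisms with
   given source and target; identities and composites are those of FuncSet (restrict, compose).
   The forgetful functor to sets is pts on objects and leaves the function unchanged. *)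
definition vhom ::
  "('a, 'v::comm_unital_quantale) vgraph \<Rightarrow> ('b, 'v) vgraph \<Rightarrow> ('a \<Rightarrow> 'b) set" where
  "vhom X Y = {f \<in> pts X \<rightarrow>\<^sub>E pts Y.
     \<forall>x\<in>pts X. \<forall>y\<in>pts X. vdist X x y \<le> vdist Y (f x) (f y)}"

definition vid :: "('a, 'v) vgraph \<Rightarrow> 'a \<Rightarrow> 'a" where
  "vid X = (\<lambda>x\<in>pts X. x)"

definition vcomp :: "('a, 'v) vgraph \<Rightarrow> ('b \<Rightarrow> 'c) \<Rightarrow> ('a \<Rightarrow> 'b) \<Rightarrow> 'a \<Rightarrow> 'c" where
  "vcomp X g f = compose (pts X) g f"

definition vhom_le ::
  "('a, 'v) vgraph \<Rightarrow> ('b, 'v::comm_unital_quantale) vgraph \<Rightarrow> ('a \<Rightarrow> 'b) \<Rightarrow> ('a \<Rightarrow> 'b) \<Rightarrow> bool" where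
  "vhom_le X Y f g \<longleftrightarrow> (\<forall>x\<in>pts X. vle Y (f x) (g x))"

definition pow_map :: "'a set \<Rightarrow> ('a \<Rightarrow> 'b) \<Rightarrow> 'a set \<Rightarrow> 'b set" where
  "pow_map S f = (\<lambda>A\<in>Pow S. f ` A)"

definition pow_unit :: "'a set \<Rightarrow> 'a \<Rightarrow> 'a set" where
  "pow_unit S = (\<lambda>x\<in>S. {x})"

definition pow_mult :: "'a set \<Rightarrow> 'a set set \<Rightarrow> 'a set" where
  "pow_mult S = (\<lambda>\<A>\<in>Pow (Pow S). \<Union>\<A>)"

definition haus :: "('a, 'v::complete_lattice) vgraph \<Rightarrow> ('a set, 'v) vgraph" where
  "haus X = \<lparr>pts = Pow (pts X), vdist = (\<lambda>A B. INF x\<in>A. SUP y\<in>B. vdist X x y)\<rparr>"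

definition haus_map ::
  "('a, 'v::complete_lattice) vgraph \<Rightarrow> ('a \<Rightarrow> 'b) \<Rightarrow> 'a set \<Rightarrow> 'b set" where
  "haus_map X f = (\<lambda>A\<in>pts (haus X). f ` A)"

definition haus_unit :: "('a, 'v) vgraph \<Rightarrow> 'a \<Rightarrow> 'a set" where
  "haus_unit X = (\<lambda>x\<in>pts X. {x})"

definition haus_mult ::
  "('a, 'v::complete_lattice) vgraph \<Rightarrow> 'a set set \<Rightarrow> 'a set" where
  "haus_mult X = (\<lambda>\<A>\<in>pts (haus (haus X)). \<Union>\<A>)"

end

theory Submission
  imports Defs
begin

text \<open>
  The powerset monad structure has to be shown compatible with the Hausdorff structure
  \<open>h A B = (INF x\<in>A. SUP y\<in>B. a x y)\<close>. All estimates rest on two facts: \<open>c \<le> h A B\<close> holds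
  as soon as \<open>c \<le> (SUP y\<in>B. a x y)\<close> for every \<open>x \<in> A\<close>, and conversely \<open>h A B\<close> is bounded
  by each of these suprema. Reflexivity of \<open>h\<close>, monotonicity on hom-sets and the
  Kock-Zoeberlein inequality follow by giving, for each element of the first set, an element
  of the second set above it; for direct images, singletons and unions the suprema themselves
  are compared. Only the triangle inequality needs the tensor to preserve suprema: for
  \<open>x \<in> A\<close>,
  \<open>(SUP y\<in>B. a x y) * h B C \<le> (SUP y\<in>B. SUP z\<in>C. a x y * a y z) \<le> (SUP z\<in>C. a x z)\<close>.

  The equations (functoriality, naturality, the monad laws) are those of the powerset monad
  on sets: since morphisms are extensional functions, they hold once they hold pointwise on
  subsets of the carrier.
\<close>

section \<open>Monotonicity of the tensor\<close>

lemma tensor_left_mono: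
  fixes x y z :: "'v::comm_unital_quantale"
  assumes "x \<le> y"
  shows "z * x \<le> z * y"
proof -
  have "z * y = z * Sup {x, y}"
    using assms by (simp add: sup.absorb2)
  also have "\<dots> = sup (z * x) (z * y)"
    unfolding mult_Sup by simp
  finally show ?thesis
    by (simp add: le_iff_sup)
qed

lemma tensor_right_mono:
  fixes x y z :: "'v::comm_unital_quantale"
  assumes "x \<le> y"
  shows "x * z \<le> y * z"
  using tensor_left_mono[OF assms, of z] by (simp add: mult.commute)

section \<open>The Hausdorff structure\<close>

lemma pts_haus [simp]: "pts (haus X) = Pow (pts X)"
  by (simp add: haus_def)

lemma vdist_haus: "vdist (haus X) A B = (INF x\<in>A. SUP y\<in>B. vdist X x y)"
  by (simp add: haus_def)

lemma vdist_haus_lower: "x \<in> A \<Longrightarrow> vdist (haus X) A B \<le> (SUP y\<in>B. vdist X x y)"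
  unfolding vdist_haus by (rule INF_lower)

lemma vdist_haus_greatest:
  "(\<And>x. x \<in> A \<Longrightarrow> c \<le> (SUP y\<in>B. vdist X x y)) \<Longrightarrow> c \<le> vdist (haus X) A B"
  unfolding vdist_haus by (rule INF_greatest)

lemma vdist_haus_greatest_witness:
  assumes "\<And>x. x \<in> A \<Longrightarrow> \<exists>y\<in>B. c \<le> vdist X x y"
  shows "c \<le> vdist (haus X) A B"
  using assms by (intro vdist_haus_greatest) (blast intro: SUP_upper2)

lemma vhomD:
  assumes "f \<in> vhom X Y"
  shows "\<And>x. x \<in> pts X \<Longrightarrow> f x \<in> pts Y"
    and "\<And>x y. x \<in> pts X \<Longrightarrow> y \<in> pts X \<Longrightarrow> vdist X x y \<le> vdist Y (f x) (f y)"
  using assms by (auto simp: vhom_def PiE_def)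

lemma vdist_haus_triangle:
  assumes X: "vcategory X" and "A \<subseteq> pts X" "B \<subseteq> pts X" "C \<subseteq> pts X"
  shows "vdist (haus X) A B * vdist (haus X) B C \<le> vdist (haus X) A C"
proof (rule vdist_haus_greatest)
  fix x assume x: "x \<in> A"
  have "vdist (haus X) A B * vdist (haus X) B C
          \<le> (SUP y\<in>B. vdist X x y) * vdist (haus X) B C"
    using x by (intro tensor_right_mono vdist_haus_lower)
  also have "\<dots> = (SUP y\<in>B. vdist X x y * vdist (haus X) B C)"
    unfolding Sup_mult by (simp add: image_image)
  also have "\<dots> \<le> (SUP z\<in>C. vdist X x z)"
  proof (rule SUP_least)
    fix y assume y: "y \<in> B"
    have "vdist X x y * vdist (haus X) B C \<le> vdist X x y * (SUP z\<in>C. vdist X y z)"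
      using y by (intro tensor_left_mono vdist_haus_lower)
    also have "\<dots> = (SUP z\<in>C. vdist X x y * vdist X y z)"
      unfolding mult_Sup by (simp add: image_image)
    also have "\<dots> \<le> (SUP z\<in>C. vdist X x z)"
    proof (rule SUP_subset_mono)
      fix z assume "z \<in> C"
      then have "x \<in> pts X" "y \<in> pts X" "z \<in> pts X"
        using x y assms(2-4) by auto
      then show "vdist X x y * vdist X y z \<le> vdist X x z"
        using X by (simp add: vcategory_def)
    qed simp
    finally show "vdist X x y * vdist (haus X) B C \<le> (SUP z\<in>C. vdist X x z)" .
  qed
  finally show "vdist (haus X) A B * vdist (haus X) B C \<le> (SUP z\<in>C. vdist X x z)" .
qed

lemma vcategory_haus:
  assumes X: "vcategory X"
  shows "vcategory (haus X)"
proof -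
  have "1 \<le> vdist (haus X) A A" if "A \<subseteq> pts X" for A
    using X that by (intro vdist_haus_greatest_witness) (auto simp: vcategory_def)
  then show ?thesis
    using vdist_haus_triangle[OF X] by (auto simp: vcategory_def[of "haus X"])
qed

section \<open>Direct images, singletons and unions as \<open>\<V>\<close>-functors\<close>

lemma haus_map_vhom:
  assumes f: "f \<in> vhom X Y"
  shows "haus_map X f \<in> vhom (haus X) (haus Y)"
proof -
  have "vdist (haus X) A B \<le> vdist (haus Y) (f ` A) (f ` B)"
    if "A \<subseteq> pts X" "B \<subseteq> pts X" for A B
  proof (rule vdist_haus_greatest)
    fix v assume "v \<in> f ` A"
    then obtain x where x: "x \<in> A" "v = f x" by blast
    have "vdist (haus X) A B \<le> (SUP y\<in>B. vdist X x y)"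
      using x(1) by (rule vdist_haus_lower)
    also have "\<dots> \<le> (SUP y\<in>B. vdist Y (f x) (f y))"
      using x that by (intro SUP_subset_mono) (auto intro: vhomD(2)[OF f])
    finally show "vdist (haus X) A B \<le> (SUP w\<in>f ` B. vdist Y v w)"
      by (simp add: x image_image)
  qed
  moreover have "f ` A \<subseteq> pts Y" if "A \<subseteq> pts X" for A
    using that vhomD(1)[OF f] by auto
  ultimately show ?thesis
    by (auto simp: vhom_def haus_map_def)
qed

lemma haus_unit_vhom: "haus_unit X \<in> vhom X (haus X)"
  by (auto simp: vhom_def haus_unit_def vdist_haus)

lemma haus_mult_vhom: "haus_mult X \<in> vhom (haus (haus X)) (haus X)"
proof -
  have "vdist (haus (haus X)) \<A> \<B> \<le> vdist (haus X) (\<Union>\<A>) (\<Union>\<B>)" for \<A> \<B>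
  proof (rule vdist_haus_greatest)
    fix x assume "x \<in> \<Union>\<A>"
    then obtain A where A: "A \<in> \<A>" "x \<in> A" by blast
    have "vdist (haus (haus X)) \<A> \<B> \<le> (SUP B\<in>\<B>. vdist (haus X) A B)"
      using A(1) by (rule vdist_haus_lower)
    also have "\<dots> \<le> (SUP B\<in>\<B>. SUP y\<in>B. vdist X x y)"
      using A(2) by (intro SUP_mono' vdist_haus_lower)
    also have "\<dots> \<le> (SUP y\<in>\<Union>\<B>. vdist X x y)"
      by (intro SUP_least SUP_upper) blast
    finally show "vdist (haus (haus X)) \<A> \<B> \<le> (SUP y\<in>\<Union>\<B>. vdist X x y)" .
  qed
  then show ?thesis
    by (auto simp: vhom_def haus_mult_def)
qed

section \<open>Functoriality, naturality and the monad laws\<close>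

lemma haus_map_vid: "haus_map X (vid X) = vid (haus X)"
  by (auto simp: haus_map_def vid_def fun_eq_iff)

lemma haus_map_vcomp:
  assumes f: "f \<in> vhom X Y"
  shows "haus_map X (vcomp X g f) = vcomp (haus X) (haus_map Y g) (haus_map X f)"
proof
  fix A
  show "haus_map X (vcomp X g f) A = vcomp (haus X) (haus_map Y g) (haus_map X f) A"
  proof (cases "A \<subseteq> pts X")
    case True
    then have "f ` A \<subseteq> pts Y"
      using vhomD(1)[OF f] by auto
    moreover have "vcomp X g f ` A = g ` f ` A"
      using True by (force simp: vcomp_def compose_def)
    ultimately show ?thesis
      using True by (simp add: haus_map_def vcomp_def compose_def)
  qed (simp add: haus_map_def vcomp_def compose_def)
qed

lemma haus_unit_natural:
  assumes f: "f \<in> vhom X Y"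
  shows "vcomp X (haus_map X f) (haus_unit X) = vcomp X (haus_unit Y) f"
  using vhomD(1)[OF f]
  by (auto simp: haus_map_def haus_unit_def vcomp_def compose_def fun_eq_iff)

lemma haus_mult_natural:
  assumes f: "f \<in> vhom X Y"
  shows "vcomp (haus (haus X)) (haus_map X f) (haus_mult X) =
    vcomp (haus (haus X)) (haus_mult Y) (haus_map (haus X) (haus_map X f))"
proof
  fix \<A>
  show "vcomp (haus (haus X)) (haus_map X f) (haus_mult X) \<A> =
    vcomp (haus (haus X)) (haus_mult Y) (haus_map (haus X) (haus_map X f)) \<A>"
  proof (cases "\<A> \<subseteq> Pow (pts X)")
    case True
    have im: "haus_map X f ` \<A> = (\<lambda>A. f ` A) ` \<A>"
      using True by (intro image_cong) (auto simp: haus_map_def)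
    have "(\<lambda>A. f ` A) ` \<A> \<subseteq> Pow (pts Y)"
      using True vhomD(1)[OF f] by blast
    moreover have "\<Union>\<A> \<subseteq> pts X"
      using True by blast
    moreover have "haus_map (haus X) (haus_map X f) \<A> = (\<lambda>A. f ` A) ` \<A>"
      using True im by (simp add: haus_map_def[of "haus X"])
    ultimately show ?thesis
      using True by (simp add: haus_map_def[of X] haus_mult_def vcomp_def compose_def image_Union)
  qed (simp add: vcomp_def compose_def)
qed

lemma haus_mult_map_unit:
  "vcomp (haus X) (haus_mult X) (haus_map X (haus_unit X)) = vid (haus X)"
proof
  fix A
  show "vcomp (haus X) (haus_mult X) (haus_map X (haus_unit X)) A = vid (haus X) A"
  proof (cases "A \<subseteq> pts X")
    case True
    then have "haus_unit X ` A = (\<lambda>x. {x}) ` A"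
      by (intro image_cong) (auto simp: haus_unit_def)
    moreover have "(\<lambda>x. {x}) ` A \<subseteq> Pow (pts X)"
      using True by blast
    ultimately show ?thesis
      using True by (simp add: haus_map_def haus_mult_def vcomp_def compose_def vid_def)
  qed (simp add: vcomp_def compose_def vid_def)
qed

lemma haus_mult_unit:
  "vcomp (haus X) (haus_mult X) (haus_unit (haus X)) = vid (haus X)"
  by (auto simp: haus_unit_def haus_mult_def vcomp_def compose_def vid_def fun_eq_iff)

lemma haus_mult_assoc:
  "vcomp (haus (haus (haus X))) (haus_mult X) (haus_map (haus (haus X)) (haus_mult X)) =
    vcomp (haus (haus (haus X))) (haus_mult X) (haus_mult (haus X))"
proof
  fix \<S>
  show "vcomp (haus (haus (haus X))) (haus_mult X) (haus_map (haus (haus X)) (haus_mult X)) \<S> =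
    vcomp (haus (haus (haus X))) (haus_mult X) (haus_mult (haus X)) \<S>"
  proof (cases "\<S> \<subseteq> Pow (Pow (pts X))")
    case True
    have "haus_mult X ` \<S> = Union ` \<S>"
      using True by (intro image_cong) (auto simp: haus_mult_def)
    moreover have "Union ` \<S> \<subseteq> Pow (pts X)"
      using True by blast
    moreover have "\<Union>\<S> \<subseteq> Pow (pts X)"
      using True by blast
    moreover have "\<Union>(Union ` \<S>) = \<Union>(\<Union>\<S>)"
      by blast
    ultimately show ?thesis
      using True
      by (simp add: haus_map_def haus_mult_def[of X] haus_mult_def[of "haus X"]
          vcomp_def compose_def)
  qed (simp add: vcomp_def compose_def)
qed

section \<open>The Kock-Zoeberlein property\<close>

lemma haus_map_mono:
  assumes "vhom_le X Y f g"
  shows "vhom_le (haus X) (haus Y) (haus_map X f) (haus_map X g)"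
proof -
  have "1 \<le> vdist (haus Y) (f ` A) (g ` A)" if "A \<subseteq> pts X" for A
    using assms that
    by (intro vdist_haus_greatest_witness) (auto simp: vhom_le_def vle_def)
  then show ?thesis
    by (auto simp: vhom_le_def vle_def haus_map_def)
qed

text \<open>
  The Kock-Zoeberlein inequality \<open>{{x} | x \<in> A} \<le> {A}\<close>: each \<open>{x}\<close> lies below \<open>A\<close>
  because \<open>x\<close> lies below itself.
\<close>

lemma haus_map_unit_le_unit:
  assumes X: "vcategory X"
  shows "vhom_le (haus X) (haus (haus X)) (haus_map X (haus_unit X)) (haus_unit (haus X))"
proof -
  have "1 \<le> vdist (haus (haus X)) (haus_unit X ` A) {A}" if A: "A \<subseteq> pts X" for A
  proof (rule vdist_haus_greatest_witness)
    fix S assume "S \<in> haus_unit X ` A"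
    then obtain x where "x \<in> A" "S = {x}"
      using A by (auto simp: haus_unit_def)
    then have "1 \<le> vdist (haus X) S A"
      using X A by (intro vdist_haus_greatest_witness) (auto simp: vcategory_def)
    then show "\<exists>B\<in>{A}. 1 \<le> vdist (haus X) S B" by simp
  qed
  then show ?thesis
    by (auto simp: vhom_le_def vle_def haus_map_def haus_unit_def[of "haus X"])
qed

section \<open>Lifting of the powerset monad\<close>

lemma haus_unit_eq_pow_unit: "haus_unit X = pow_unit (pts X)"
  by (simp add: haus_unit_def pow_unit_def)

lemma haus_mult_eq_pow_mult: "haus_mult X = pow_mult (pts X)"
  by (simp add: haus_mult_def pow_mult_def)

lemma haus_map_eq_pow_map: "haus_map X f = pow_map (pts X) f"
  by (simp add: haus_map_def pow_map_def)

(* The type variables 'a, 'b, 'c are independent and range over all types, so X, Y, Z are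
   arbitrary V-categories. The blocks are: H is an endofunctor of V-Cat; the unit and the
   multiplication are natural transformations; the monad laws; the Kock-Zoeberlein property;
   compatibility with the powerset monad along the forgetful functor. *)
theorem theorem2:
  "(\<forall>X :: ('a, 'v::comm_unital_quantale) vgraph. vcategory X \<longrightarrow>
      vcategory (haus X) \<and>
      haus_map X (vid X) = vid (haus X)) \<and>
   (\<forall>(X :: ('a, 'v) vgraph) (Y :: ('b, 'v) vgraph). vcategory X \<longrightarrow> vcategory Y \<longrightarrow>
      (\<forall>f\<in>vhom X Y. haus_map X f \<in> vhom (haus X) (haus Y))) \<and>
   (\<forall>(X :: ('a, 'v) vgraph) (Y :: ('b, 'v) vgraph) (Z :: ('c, 'v) vgraph).
      vcategory X \<longrightarrow> vcategory Y \<longrightarrow> vcategory Z \<longrightarrow>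
      (\<forall>f\<in>vhom X Y. \<forall>g\<in>vhom Y Z.
         haus_map X (vcomp X g f) = vcomp (haus X) (haus_map Y g) (haus_map X f))) \<and>

   (\<forall>X :: ('a, 'v) vgraph. vcategory X \<longrightarrow>
      haus_unit X \<in> vhom X (haus X) \<and>
      haus_mult X \<in> vhom (haus (haus X)) (haus X)) \<and>
   (\<forall>(X :: ('a, 'v) vgraph) (Y :: ('b, 'v) vgraph). vcategory X \<longrightarrow> vcategory Y \<longrightarrow>
      (\<forall>f\<in>vhom X Y.
         vcomp X (haus_map X f) (haus_unit X) = vcomp X (haus_unit Y) f \<and>
         vcomp (haus (haus X)) (haus_map X f) (haus_mult X) =
           vcomp (haus (haus X)) (haus_mult Y) (haus_map (haus X) (haus_map X f)))) \<and>

   (\<forall>X :: ('a, 'v) vgraph. vcategory X \<longrightarrow>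
      vcomp (haus X) (haus_mult X) (haus_map X (haus_unit X)) = vid (haus X) \<and>
      vcomp (haus X) (haus_mult X) (haus_unit (haus X)) = vid (haus X) \<and>
      vcomp (haus (haus (haus X))) (haus_mult X) (haus_map (haus (haus X)) (haus_mult X)) =
        vcomp (haus (haus (haus X))) (haus_mult X) (haus_mult (haus X))) \<and>

   (\<forall>(X :: ('a, 'v) vgraph) (Y :: ('b, 'v) vgraph). vcategory X \<longrightarrow> vcategory Y \<longrightarrow>
      (\<forall>f\<in>vhom X Y. \<forall>g\<in>vhom X Y. vhom_le X Y f g \<longrightarrow>
         vhom_le (haus X) (haus Y) (haus_map X f) (haus_map X g))) \<and>
   (\<forall>X :: ('a, 'v) vgraph. vcategory X \<longrightarrow>
      vhom_le (haus X) (haus (haus X)) (haus_map X (haus_unit X)) (haus_unit (haus X))) \<and>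

   (\<forall>X :: ('a, 'v) vgraph. vcategory X \<longrightarrow>
      pts (haus X) = Pow (pts X) \<and>
      haus_unit X = pow_unit (pts X) \<and>
      haus_mult X = pow_mult (pts X)) \<and>
   (\<forall>(X :: ('a, 'v) vgraph) (Y :: ('b, 'v) vgraph). vcategory X \<longrightarrow> vcategory Y \<longrightarrow>
      (\<forall>f\<in>vhom X Y. haus_map X f = pow_map (pts X) f))"
  by (intro conjI allI ballI impI)
    (simp_all add: vcategory_haus haus_map_vid haus_map_vhom haus_map_vcomp haus_unit_vhom
      haus_mult_vhom haus_unit_natural haus_mult_natural haus_mult_map_unit haus_mult_unit
      haus_mult_assoc haus_map_mono haus_map_unit_le_unit haus_unit_eq_pow_unit[symmetric]
      haus_mult_eq_pow_mult[symmetric] haus_map_eq_pow_map[symmetric])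

end
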